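(* Let $\mathcal I=\{0\}\cup\mathcal I_{\mathrm g}$ be the finite index set, and suppose that the observation noise $\epsilon_t=[\epsilon_{0,t},\ldots,\epsilon_{|\mathcal I_{\mathrm g}|,t}]^\top$ is defined on the probability space $(\Omega,\mathcal F,\mathbb P)$, from which one can sample. Let $\nu,\kappa\in(0,1)$ be arbitrary. For every $t\ge 1$ set $\kappa_t=\frac{6\kappa}{\pi^2t^2}$, let $m_t$ be the smallest natural number with $$\sum_{s=0}^{|\mathcal I|-1}\binom{m_t}{s}\nu^s(1-\nu)^{m_t-s}\le\kappa_t ,$$ let $\tilde\epsilon_t^{(j)}$, $j\in\{1,\ldots,m_t\}$, be i.i.d. samples (scenarios) from $(\Omega,\mathcal F,\mathbb P)$, drawn independently across $t$, and let $\bar\epsilon_t=[\bar\epsilon_{0,t},\ldots,\bar\epsilon_{|\mathcal I_{\mathrm g}|,t}]^\top$ with $\bar\epsilon_{i,t}=\max_{1\le j\le m_t}|\tilde\epsilon_{i,t}^{(j)}|$. Let $V_t(\bar\epsilon_t)=\mathbb P[\exists i\in\mathcal I:\ \bar\epsilon_{i,t}<|\epsilon_{i,t}|]$. Then $V_t(\bar\epsilon_t)\le\nu$ holds simultaneously for all $t\ge1$ with confidence at least $1-\kappa$, i.e. $$\tilde{\mathbb P}\Big[\bigcup_{t\ge 1}\{V_t(\bar\epsilon_t)>\nu\}\Big]\le\kappa .$$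
   Context: $\mathcal I_{\mathrm g}=\{1,\ldots,|\mathcal I_{\mathrm g}|\}\subseteq\mathbb N$ is a finite index set (of constraints) and $\mathcal I=\{0\}\cup\mathcal I_{\mathrm g}$. The noise $\epsilon_t$ is an $\mathbb R^{|\mathcal I|}$-valued random vector, and "i.i.d. samples from $(\Omega,\mathcal F,\mathbb P)$" means independent copies of the noise vector; $\tilde\epsilon_{i,t}^{(j)}$ denotes the $i$-th component of $\tilde\epsilon_t^{(j)}$. The vector $\bar\epsilon_t$ is the solution of the scenario program $\min_{\bar\epsilon_t\in\mathbb R_{\ge0}^{|\mathcal I|}}\mathbf 1^\top\bar\epsilon_t$ subject to $\bar\epsilon_{i,t}\ge|\tilde\epsilon_{i,t}^{(j)}|$ for all $j\in\{1,\ldots,m_t\}$ and $i\in\mathcal I$. In the violation probability $V_t(\bar\epsilon_t)$ the vector $\bar\epsilon_t$ is held fixed and the probability $\mathbb P$ is over the observation noise $\epsilon_t$; hence $V_t(\bar\epsilon_t)$ is a random variable depending on the scenarios. The scenarios of all iterations live on the master probability space $(\tilde\Omega,\tilde{\mathcal F},\tilde{\mathbb P})$ with $\tilde\Omega=\bigotimes_{t=1}^\infty\Omega^{m_t}$, $\tilde{\mathcal F}=\bigotimes_{t=1}^\infty\mathcal F^{m_t}$, $\tilde{\mathbb P}=\bigotimes_{t=1}^\infty\mathbb P^{m_t}$, where $(\Omega^{m_t},\mathcal F^{m_t},\mathbb P^{m_t})$ is the $m_t$-fold product probability space. *)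

theory Defs
  imports "HOL-Probability.Probability"
begin

text \<open>
  Noise vectors are functions \<^typ>\<open>nat \<Rightarrow> real\<close> of which only the components in
  \<open>index_set n\<close> matter; here \<open>n\<close> is the number of constraints.
\<close>

definition index_set :: "nat \<Rightarrow> nat set" where
  "index_set n = {0} \<union> {1..n}"

definition conf_level :: "real \<Rightarrow> nat \<Rightarrow> real" where
  "conf_level \<kappa> t = 6 * \<kappa> / (pi ^ 2 * real t ^ 2)"

text \<open>
  The truncated subtraction \<open>m - s\<close> is harmless, as \<open>m choose s = 0\<close> for \<open>s > m\<close>.
  For \<open>m = 0\<close> the sum is \<open>1\<close>, so the minimum is positive for every level below \<open>1\<close>.
\<close>

definition num_scenarios :: "nat \<Rightarrow> real \<Rightarrow> real \<Rightarrow> nat \<Rightarrow> nat" where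
  "num_scenarios n \<nu> \<kappa> t =
     (LEAST m. (\<Sum>s = 0..card (index_set n) - 1.
        real (m choose s) * \<nu> ^ s * (1 - \<nu>) ^ (m - s)) \<le> conf_level \<kappa> t)"

text \<open>
  A point \<open>\<omega>\<close> of the master space assigns to \<open>t \<ge> 1\<close> and \<open>1 \<le> j \<le> m t\<close> an outcome
  \<open>\<omega> t j\<close> of the space \<open>M\<close> on which the noise lives.
\<close>

definition master_space :: "'a measure \<Rightarrow> (nat \<Rightarrow> nat) \<Rightarrow> (nat \<Rightarrow> nat \<Rightarrow> 'a) measure" where
  "master_space M m = (\<Pi>\<^sub>M t\<in>{1..}. \<Pi>\<^sub>M j\<in>{1..m t}. M)"

definition scenario ::
  "(nat \<Rightarrow> 'a \<Rightarrow> nat \<Rightarrow> real) \<Rightarrow> (nat \<Rightarrow> nat \<Rightarrow> 'a) \<Rightarrow> nat \<Rightarrow> nat \<Rightarrow> nat \<Rightarrow> real" where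
  "scenario \<epsilon> \<omega> t j = \<epsilon> t (\<omega> t j)"

definition noise_bound ::
  "(nat \<Rightarrow> 'a \<Rightarrow> nat \<Rightarrow> real) \<Rightarrow> (nat \<Rightarrow> nat) \<Rightarrow> (nat \<Rightarrow> nat \<Rightarrow> 'a) \<Rightarrow> nat \<Rightarrow> nat \<Rightarrow> real" where
  "noise_bound \<epsilon> m \<omega> t i = Max ((\<lambda>j. \<bar>scenario \<epsilon> \<omega> t j i\<bar>) ` {1..m t})"

definition violation ::
  "'a measure \<Rightarrow> nat \<Rightarrow> (nat \<Rightarrow> 'a \<Rightarrow> nat \<Rightarrow> real) \<Rightarrow> nat \<Rightarrow> (nat \<Rightarrow> real) \<Rightarrow> real" where
  "violation M n \<epsilon> t b = measure M {x \<in> space M. \<exists>i\<in>index_set n. b i < \<bar>\<epsilon> t x i\<bar>}"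

end

theory Submission imports Defs begin

text \<open>
  For a single \<open>t\<close>, the tail bound \<open>\<Sum>s<d. (m choose s) * \<nu>^s * (1 - \<nu>)^(m - s)\<close>, \<open>d = |I|\<close>, is obtained
  by treating the components one after the other. The sample with the largest first component cuts
  the space down to a part whose probability \<open>u\<close> is uniformly distributed (after breaking ties), and
  the remaining \<open>m - 1\<close> samples are independent on this part and have to bound only \<open>d - 1\<close>
  components. Hence the homogeneous tail \<open>b d m u p = \<Sum>s<d. (m choose s) * (u - p)^s * p^(m - s)\<close>
  bounds the probability that \<open>m\<close> samples from a part of probability \<open>u\<close> span a box of probability
  less than \<open>p\<close>, because it satisfies \<open>b d m c p = p^m + m * \<integral>\<^bsub>p\<^esub>\<^bsup>c\<^esup> b (d - 1) (m - 1) u p du\<close>. The theorem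
  follows by a union bound over \<open>t\<close>, as the levels \<open>\<kappa>\<^sub>t\<close> sum to \<open>\<kappa>\<close>.
\<close>

subsection \<open>Atomless preorders\<close>

text \<open>Abstracts the comparison of samples by one real component with a continuous
  distribution. Ties are allowed but null, so that a lexicographic order on a product space is an
  instance.\<close>

locale atomless_preorder = prob_space P for P :: "'b measure" +
  fixes le :: "'b \<Rightarrow> 'b \<Rightarrow> bool" (infix "\<preceq>" 50)
  assumes le_measurable [measurable]: "Measurable.pred (P \<Otimes>\<^sub>M P) (\<lambda>(x, y). x \<preceq> y)"
    and total: "x \<preceq> y \<or> y \<preceq> x"
    and trans: "x \<preceq> y \<Longrightarrow> y \<preceq> z \<Longrightarrow> x \<preceq> z"
    and null_classes: "z \<in> space P \<Longrightarrow> prob {x \<in> space P. x \<preceq> z \<and> z \<preceq> x} = 0"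
begin

lemma le_measurable' [measurable (raw)]:
  assumes [measurable]: "f \<in> N \<rightarrow>\<^sub>M P" "g \<in> N \<rightarrow>\<^sub>M P"
  shows "Measurable.pred N (\<lambda>x. f x \<preceq> g x)"
  using measurable_compose[OF measurable_Pair[OF assms] le_measurable] by simp

lemma refl: "x \<preceq> x"
  using total by blast

text \<open>Lets bounds proved for initial segments be reused for final segments.\<close>

lemma converse: "atomless_preorder P (\<lambda>x y. y \<preceq> x)"
proof
  show "Measurable.pred (P \<Otimes>\<^sub>M P) (\<lambda>(x, y). y \<preceq> x)"
    by measurable
  show "y \<preceq> x \<or> x \<preceq> y" for x y
    using total by blast
  show "z \<preceq> x" if "y \<preceq> x" "z \<preceq> y" for x y z
    using trans that by blast
  show "prob {x \<in> space P. z \<preceq> x \<and> x \<preceq> z} = 0" if "z \<in> space P" for z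
    using null_classes[OF that] by (simp add: conj_commute)
qed

lemma obtain_maximal:
  assumes "finite J" "J \<noteq> {}"
  obtains j where "j \<in> J" "\<And>k. k \<in> J \<Longrightarrow> x k \<preceq> x j"
proof -
  have "\<exists>j\<in>J. \<forall>k\<in>J. x k \<preceq> x j"
    using assms
  proof (induction rule: finite_ne_induct)
    case (insert a J)
    then obtain j where j: "j \<in> J" "\<And>k. k \<in> J \<Longrightarrow> x k \<preceq> x j"
      by blast
    show ?case
    proof (cases "x a \<preceq> x j")
      case True
      then show ?thesis
        using j by blast
    next
      case False
      then have "x j \<preceq> x a"
        using total by blast
      then have "\<forall>k\<in>insert a J. x k \<preceq> x a"
        using j(2) trans[OF _ \<open>x j \<preceq> x a\<close>] refl by auto
      then show ?thesis
        by blast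
    qed
  qed (simp add: refl)
  then obtain j where "j \<in> J" "\<forall>k\<in>J. x k \<preceq> x j"
    by (elim bexE)
  then show ?thesis
    by (intro that) auto
qed

text \<open>
  Product measurability of the order is essential here: for a well-order of type \<open>\<omega>\<^sub>1\<close> all proper
  initial segments are countable.
\<close>

lemma prob_eq_0_if_down_null:
  assumes A [measurable]: "A \<in> events" and null: "\<And>z. z \<in> A \<Longrightarrow> prob {x \<in> A. x \<preceq> z} = 0"
  shows "prob A = 0"
proof -
  interpret PP: pair_prob_space P P ..
  \<comment> \<open>\<open>?S\<close> has null sections for a fixed second component,
    \<open>?T\<close> for a fixed first one. By totality they cover \<open>A \<times> A\<close>, so
    the square of \<open>prob A\<close> is zero.\<close>
  let ?S = "{p \<in> space (P \<Otimes>\<^sub>M P). fst p \<in> A \<and> snd p \<in> A \<and> fst p \<preceq> snd p}"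
  let ?T = "{p \<in> space (P \<Otimes>\<^sub>M P). fst p \<in> A \<and> snd p \<in> A \<and> snd p \<preceq> fst p}"
  have ST [measurable]: "?S \<in> sets (P \<Otimes>\<^sub>M P)" "?T \<in> sets (P \<Otimes>\<^sub>M P)"
    by measurable
  have A_space: "A \<subseteq> space P"
    using A sets.sets_into_space by blast
  have "emeasure P ((\<lambda>x. (x, z)) -` ?S) = 0" for z
  proof (cases "z \<in> A")
    case True
    then have "(\<lambda>x. (x, z)) -` ?S = {x \<in> A. x \<preceq> z}"
      using A_space by (auto simp: space_pair_measure)
    then show ?thesis
      using null[OF True] by (simp add: emeasure_eq_measure)
  qed (auto simp: space_pair_measure)
  then have S0: "emeasure (P \<Otimes>\<^sub>M P) ?S = 0"
    by (subst PP.emeasure_pair_measure_alt2[OF ST(1)]) simp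
  have "emeasure P (Pair z -` ?T) = 0" for z
  proof (cases "z \<in> A")
    case True
    then have "Pair z -` ?T = {x \<in> A. x \<preceq> z}"
      using A_space by (auto simp: space_pair_measure)
    then show ?thesis
      using null[OF True] by (simp add: emeasure_eq_measure)
  qed (auto simp: space_pair_measure)
  then have T0: "emeasure (P \<Otimes>\<^sub>M P) ?T = 0"
    by (subst emeasure_pair_measure_alt[OF ST(2)]) simp
  have "A \<times> A \<subseteq> ?S \<union> ?T"
    using A_space total by (auto simp: space_pair_measure)
  then have "emeasure (P \<Otimes>\<^sub>M P) (A \<times> A) \<le> emeasure (P \<Otimes>\<^sub>M P) (?S \<union> ?T)"
    by (intro emeasure_mono) auto
  also have "\<dots> \<le> emeasure (P \<Otimes>\<^sub>M P) ?S + emeasure (P \<Otimes>\<^sub>M P) ?T"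
    by (intro emeasure_subadditive) auto
  finally have "emeasure P A * emeasure P A = 0"
    using S0 T0 by (simp add: emeasure_pair_measure_Times)
  then show ?thesis
    by (simp add: emeasure_eq_measure)
qed

text \<open>
  If the probability of the initial segments of \<open>A\<close> has a maximum, attained at \<open>z0\<close>, the part of \<open>A\<close>
  above \<open>z0\<close> is null; otherwise countably many initial segments exhaust \<open>A\<close>.
\<close>

lemma prob_le_if_down_le:
  assumes A [measurable]: "A \<in> events"
    and down: "\<And>z. z \<in> A \<Longrightarrow> prob {x \<in> A. x \<preceq> z} \<le> u" and "0 \<le> u"
  shows "prob A \<le> u"
proof (cases "A = {}")
  case False
  have A_space: "A \<subseteq> space P"
    using A sets.sets_into_space by blast
  define g where "g z = prob {x \<in> A. x \<preceq> z}" for z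
  have sets_down [measurable]: "{x \<in> A. x \<preceq> z} \<in> events" if "z \<in> A" for z
  proof -
    have [measurable]: "z \<in> space P" using that A_space by auto
    have "{x \<in> A. x \<preceq> z} = {x \<in> space P. x \<in> A \<and> x \<preceq> z}" using A_space by auto
    also have "\<dots> \<in> events" by measurable
    finally show ?thesis .
  qed
  have g_mono: "g x \<le> g y" if "x \<preceq> y" "y \<in> A" for x y
    unfolding g_def using that trans by (intro finite_measure_mono) auto
  have bdd: "bdd_above (g ` A)"
    by (auto simp: g_def intro!: bdd_aboveI[of _ 1])
  show ?thesis
  proof (cases "\<exists>z0\<in>A. \<forall>z\<in>A. g z \<le> g z0")
    case True
    then obtain z0 where z0: "z0 \<in> A" "\<And>z. z \<in> A \<Longrightarrow> g z \<le> g z0"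
      by blast
    let ?B = "{x \<in> A. x \<preceq> z0}"
    have B [measurable]: "?B \<in> events"
      using sets_down z0(1) by blast
    have "prob (A - ?B) = 0"
    proof (rule prob_eq_0_if_down_null)
      fix z assume z: "z \<in> A - ?B"
      then have "z0 \<preceq> z"
        using total by blast
      have "{x \<in> A - ?B. x \<preceq> z} = {x \<in> A. x \<preceq> z} - ?B"
        by blast
      moreover have "?B \<subseteq> {x \<in> A. x \<preceq> z}"
        using \<open>z0 \<preceq> z\<close> trans by blast
      ultimately have "prob {x \<in> A - ?B. x \<preceq> z} = g z - g z0"
        using z B sets_down[of z] unfolding g_def by (simp add: finite_measure_Diff)
      then show "prob {x \<in> A - ?B. x \<preceq> z} = 0"
        using z0(2)[of z] z measure_nonneg[of P "{x \<in> A - ?B. x \<preceq> z}"] by simp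
    qed measurable
    moreover have "prob (A - ?B) = prob A - prob ?B"
      using B by (intro finite_measure_Diff) auto
    ultimately show ?thesis
      using down[OF z0(1)] by simp
  next
    case False
    define s where "s = Sup (g ` A)"
    have "\<exists>z\<in>A. s - 1 / (real n + 1) < g z" for n
      using less_cSup_iff[OF _ bdd, of "s - 1 / (real n + 1)"] \<open>A \<noteq> {}\<close> unfolding s_def by fastforce
    then obtain Z where Z: "\<And>n. Z n \<in> A" "\<And>n. s - 1 / (real n + 1) < g (Z n)"
      by metis
    \<comment> \<open>The points \<open>Z n\<close> need not increase, so finite unions supply an
      increasing sequence; by totality each union is a single initial segment and inherits the bound
      \<open>u\<close>.\<close>
    define C where "C n = (\<Union>k\<le>n. {x \<in> A. x \<preceq> Z k})" for n
    have C_chain: "\<exists>k. C n = {x \<in> A. x \<preceq> Z k}" for n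
    proof (induction n)
      case (Suc n)
      then obtain k where k: "C n = {x \<in> A. x \<preceq> Z k}"
        by blast
      have "C (Suc n) = C n \<union> {x \<in> A. x \<preceq> Z (Suc n)}"
        by (auto simp: C_def atMost_Suc)
      then have "C (Suc n) = {x \<in> A. x \<preceq> Z k} \<or> C (Suc n) = {x \<in> A. x \<preceq> Z (Suc n)}"
        unfolding k using total[of "Z k" "Z (Suc n)"] trans by blast
      then show ?case
        by blast
    qed (auto simp: C_def)
    have C_le: "prob (C n) \<le> u" and C_sets: "C n \<in> events" for n
      using C_chain[of n] down Z(1) sets_down by auto
    have "\<exists>n. x \<in> C n" if x: "x \<in> A" for x
    proof -
      obtain z where z: "z \<in> A" "g x < g z"
        using False x by (meson not_le)
      \<comment> \<open>The supremum is not attained here, so some \<open>g (Z n)\<close> exceeds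
        \<open>g x\<close> and \<open>Z n\<close> lies above \<open>x\<close>.\<close>
      then have "g x < s"
        unfolding s_def using bdd by (meson cSUP_upper less_le_trans)
      then obtain n where "1 / (real n + 1) < s - g x"
        using reals_Archimedean[of "s - g x"] by (auto simp: inverse_eq_divide add.commute)
      then have "g x < g (Z n)"
        using Z(2)[of n] by simp
      then have "\<not> Z n \<preceq> x"
        using g_mono[of "Z n" x] x by auto
      then have "x \<preceq> Z n"
        using total by blast
      then show ?thesis
        using x unfolding C_def by blast
    qed
    then have "(\<Union>n. C n) = A"
      by (auto simp: C_def)
    moreover have "incseq C"
      by (fastforce simp: C_def incseq_def)
    ultimately have "(\<lambda>n. prob (C n)) \<longlonglongrightarrow> prob A"
      using finite_Lim_measure_incseq[of C] C_sets by auto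
    then show ?thesis
      using C_le by (intro LIMSEQ_le_const2) auto
  qed
qed (use \<open>0 \<le> u\<close> in simp)

text \<open>The distribution function of \<open>P\<close> restricted to \<open>D\<close>, left
  unnormalised: its values lie in \<open>[0, prob D]\<close>.\<close>

definition cumul :: "'b set \<Rightarrow> 'b \<Rightarrow> real" where
  "cumul D z = prob {x \<in> space P. x \<in> D \<and> x \<preceq> z}"

lemma cumul_measurable [measurable]:
  assumes [measurable]: "D \<in> events"
  shows "cumul D \<in> borel_measurable P"
  unfolding cumul_def by measurable

lemma cumul_bounds:
  assumes "D \<in> events"
  shows "0 \<le> cumul D z" "cumul D z \<le> prob D"
  unfolding cumul_def using assms by (auto intro!: finite_measure_mono)

lemma cumul_mono:
  assumes [measurable]: "D \<in> events" and "x \<preceq> y" "y \<in> space P"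
  shows "cumul D x \<le> cumul D y"
  unfolding cumul_def using assms trans by (intro finite_measure_mono) auto

text \<open>Below any of its points \<open>z\<close>, the set lies inside the segment that
  \<open>cumul D z\<close> measures, so \<open>prob_le_if_down_le\<close> applies.\<close>

lemma prob_cumul_le:
  assumes [measurable]: "D \<in> events" and "0 \<le> u"
  shows "prob {z \<in> space P. z \<in> D \<and> cumul D z \<le> u} \<le> u"
proof (rule prob_le_if_down_le)
  let ?A = "{z \<in> space P. z \<in> D \<and> cumul D z \<le> u}"
  fix z assume z: "z \<in> ?A"
  then have [measurable]: "z \<in> space P" by simp
  have "prob {x \<in> ?A. x \<preceq> z} \<le> cumul D z"
    unfolding cumul_def by (intro finite_measure_mono) auto
  then show "prob {x \<in> ?A. x \<preceq> z} \<le> u"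
    using z by simp
qed (use \<open>0 \<le> u\<close> in measurable)

text \<open>Dual bound, by the reversed order. Points of \<open>D\<close> above \<open>z\<close>
  avoid the segment measured by \<open>cumul D z\<close>, except those equivalent to
  \<open>z\<close>, which are null by \<open>null_classes\<close>.\<close>

lemma prob_cumul_gt_le:
  assumes D [measurable]: "D \<in> events" and "u \<le> prob D"
  shows "prob {z \<in> space P. z \<in> D \<and> u < cumul D z} \<le> prob D - u"
proof (rule atomless_preorder.prob_le_if_down_le[OF converse])
  let ?A = "{z \<in> space P. z \<in> D \<and> u < cumul D z}"
  fix z assume z: "z \<in> ?A"
  then have zs [measurable]: "z \<in> space P" by simp
  have D_space: "D \<subseteq> space P"
    using D sets.sets_into_space by blast
  let ?N = "{x \<in> space P. x \<preceq> z \<and> z \<preceq> x}" and ?L = "{x \<in> space P. x \<in> D \<and> x \<preceq> z}"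
  have "prob {x \<in> ?A. z \<preceq> x} \<le> prob ((D - ?L) \<union> ?N)"
    by (intro finite_measure_mono) auto
  also have "\<dots> \<le> prob (D - ?L) + prob ?N"
    by (intro measure_Un_le) auto
  also have "\<dots> = prob D - cumul D z"
    unfolding cumul_def null_classes[OF zs] by (subst finite_measure_Diff) auto
  finally show "prob {x \<in> ?A. z \<preceq> x} \<le> prob D - u"
    using z by simp
qed (use \<open>u \<le> prob D\<close> in \<open>measurable, simp\<close>)

text \<open>The set and its complement in \<open>D\<close> have upper bounds that add up to
  \<open>prob D\<close>, so both are attained.\<close>

lemma prob_cumul_gt:
  assumes D [measurable]: "D \<in> events" and "0 \<le> u" "u \<le> prob D"
  shows "prob {z \<in> space P. z \<in> D \<and> u < cumul D z} = prob D - u"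
proof -
  let ?A = "{z \<in> space P. z \<in> D \<and> cumul D z \<le> u}"
  let ?B = "{z \<in> space P. z \<in> D \<and> u < cumul D z}"
  have "D = ?A \<union> ?B"
    using sets.sets_into_space[OF D] by auto
  then have "prob D = prob (?A \<union> ?B)"
    by simp
  also have "\<dots> = prob ?A + prob ?B"
    by (intro finite_measure_Union) auto
  finally show ?thesis
    using prob_cumul_le[OF D \<open>0 \<le> u\<close>] prob_cumul_gt_le[OF D \<open>u \<le> prob D\<close>] by linarith
qed

text \<open>Probability integral transform on \<open>D\<close>. Open half-lines determine the
  measures; those starting in \<open>[0, prob D]\<close> are settled by
  \<open>prob_cumul_gt\<close>, the others contain all or none of the values.\<close>

lemma distr_cumul:
  assumes D [measurable]: "D \<in> events"
  shows "distr (density P (indicator D)) borel (cumul D) = density lborel (indicator {0..prob D})"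
    (is "?L = ?R")
proof (rule measure_eqI_lessThan)
  have L: "emeasure ?L {x<..} = prob {z \<in> space P. z \<in> D \<and> x < cumul D z}" for x
  proof -
    have "emeasure ?L {x<..} =
        (\<integral>\<^sup>+ z. indicator D z * indicator (cumul D -` {x<..} \<inter> space P) z \<partial>P)"
      by (simp add: emeasure_distr emeasure_density)
    also have "\<dots> = (\<integral>\<^sup>+ z. indicator {z \<in> space P. z \<in> D \<and> x < cumul D z} z \<partial>P)"
      by (intro nn_integral_cong) (auto split: split_indicator)
    finally show ?thesis
      by (simp add: emeasure_eq_measure)
  qed
  show "emeasure ?L {x<..} < \<infinity>" for x
    unfolding L by simp
  show "emeasure ?L {x<..} = emeasure ?R {x<..}" for x
  proof -
    have "emeasure ?R {x<..} = (\<integral>\<^sup>+ u. indicator {0..prob D} u * indicator {x<..} u \<partial>lborel)"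
      by (rule emeasure_density) auto
    then have R: "emeasure ?R {x<..} = emeasure lborel ({0..prob D} \<inter> {x<..})"
      by (simp flip: indicator_inter_arith)
    consider "x < 0" | "0 \<le> x" "x \<le> prob D" | "prob D < x"
      by linarith
    then show ?thesis
    proof cases
      case 1
      then have "{0..prob D} \<inter> {x<..} = {0..prob D}"
        by auto
      moreover have "{z \<in> space P. z \<in> D \<and> x < cumul D z} = D"
        using 1 sets.sets_into_space[OF D] cumul_bounds(1)[OF D] by (auto intro: less_le_trans)
      ultimately show ?thesis
        unfolding L R by simp
    next
      case 2
      then have "{0..prob D} \<inter> {x<..} = {x<..prob D}"
        by auto
      then show ?thesis
        unfolding L R prob_cumul_gt[OF D 2] using 2 by simp
    next
      case 3
      then have "{0..prob D} \<inter> {x<..} = {}"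
        by auto
      moreover have "{z \<in> space P. z \<in> D \<and> x < cumul D z} = {}"
        using 3 cumul_bounds(2)[OF D] by (auto simp: not_less intro: order_trans less_imp_le)
      ultimately show ?thesis
        unfolding L R by (simp only: emeasure_empty measure_empty ennreal_0)
    qed
  qed
qed auto

text \<open>Replaces integration over the maximal sample by integration over the probability below
  it.\<close>

lemma nn_integral_cumul:
  assumes D [measurable]: "D \<in> events" and [measurable]: "f \<in> borel_measurable borel"
  shows "(\<integral>\<^sup>+ z. f (cumul D z) * indicator D z \<partial>P) = (\<integral>\<^sup>+ u. f u * indicator {0..prob D} u \<partial>lborel)"
proof -
  have "(\<integral>\<^sup>+ z. f (cumul D z) * indicator D z \<partial>P) = (\<integral>\<^sup>+ u. f u \<partial>distr (density P (indicator D)) borel (cumul D))"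
    by (simp add: nn_integral_distr nn_integral_density mult.commute)
  also have "\<dots> = (\<integral>\<^sup>+ u. f u * indicator {0..prob D} u \<partial>lborel)"
    unfolding distr_cumul[OF D] by (simp add: nn_integral_density mult.commute)
  finally show ?thesis .
qed

end

subsection \<open>Binomial tails and boxes\<close>

text \<open>For \<open>u = 1\<close>, the probability of fewer than \<open>d\<close> successes in
  \<open>m\<close> trials of success rate \<open>1 - p\<close>. The total mass \<open>u\<close>
  varies because the recursion passes to parts of the space.\<close>

definition binomial_tail :: "nat \<Rightarrow> nat \<Rightarrow> real \<Rightarrow> real \<Rightarrow> real" where
  "binomial_tail d m u p = (\<Sum>s<d. real (m choose s) * (u - p) ^ s * p ^ (m - s))"

lemma binomial_tail_measurable [measurable]:
  "(\<lambda>u. binomial_tail d m u p) \<in> borel_measurable borel"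
  unfolding binomial_tail_def by measurable

lemma binomial_tail_nonneg: "0 \<le> p \<Longrightarrow> p \<le> u \<Longrightarrow> 0 \<le> binomial_tail d m u p"
  unfolding binomial_tail_def by (intro sum_nonneg) auto

lemma binomial_tail_Suc_0: "binomial_tail (Suc d) 0 u p = 1"
  unfolding binomial_tail_def by (simp add: lessThan_Suc_eq_insert_0 sum.reindex)

lemma binomial_tail_self: "binomial_tail (Suc d) m p p = p ^ m"
  unfolding binomial_tail_def by (simp add: lessThan_Suc_eq_insert_0 sum.reindex)

text \<open>The term \<open>s = 0\<close> is constant in \<open>u\<close>; the absorption identity
  for binomial coefficients turns the others into the terms of the smaller tail.\<close>

lemma binomial_tail_deriv:
  "((\<lambda>u. binomial_tail (Suc d) (Suc m) u p) has_real_derivative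
      real (Suc m) * binomial_tail d m u p) (at u)"
proof -
  have *: "real (Suc m choose Suc s) * (real (Suc s) * (u - p) ^ s) * p ^ (Suc m - Suc s) =
      real (Suc m) * (real (m choose s) * (u - p) ^ s * p ^ (m - s))" for s
  proof -
    have "real (Suc m choose Suc s) * real (Suc s) = real (Suc m) * real (m choose s)"
      using Suc_times_binomial_eq[of m s] unfolding of_nat_mult[symmetric] by simp
    then show ?thesis
      by (simp only: mult.assoc[symmetric] diff_Suc_Suc)
  qed
  have "((\<lambda>u. real (Suc m choose 0) * (u - p) ^ 0 * p ^ (Suc m - 0) +
        (\<Sum>s<d. real (Suc m choose Suc s) * (u - p) ^ Suc s * p ^ (Suc m - Suc s)))
      has_real_derivative
        (\<Sum>s<d. real (Suc m choose Suc s) * (real (Suc s) * (u - p) ^ s) * p ^ (Suc m - Suc s))) (at u)"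
    by (auto intro!: derivative_eq_intros simp del: binomial_Suc_Suc power_Suc of_nat_Suc
        intro!: sum.cong simp: mult_ac)
  then show ?thesis
    unfolding binomial_tail_def sum.lessThan_Suc_shift * sum_distrib_left .
qed

text \<open>Fundamental theorem of calculus; at the lower end \<open>u = p\<close> only the term
  \<open>s = 0\<close> survives.\<close>

lemma nn_integral_binomial_tail:
  assumes "0 \<le> p" "p \<le> c"
  shows "(\<integral>\<^sup>+ u. ennreal (real (Suc m) * binomial_tail d m u p) * indicator {p..c} u \<partial>lborel) =
    ennreal (binomial_tail (Suc d) (Suc m) c p - p ^ Suc m)"
  using nn_integral_FTC_Icc[of "\<lambda>u. real (Suc m) * binomial_tail d m u p" p c
      "\<lambda>u. binomial_tail (Suc d) (Suc m) u p"] assms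
  by (simp add: binomial_tail_self binomial_tail_nonneg DERIV_subset[OF binomial_tail_deriv]
      del: of_nat_Suc power_Suc)

section \<open>Samples spanning a box of small probability\<close>

lemma pred_box:
  assumes "finite I" "\<And>i. i \<in> I \<Longrightarrow> atomless_preorder P (le i)" "finite K"
    and "g \<in> N \<rightarrow>\<^sub>M P" "\<And>k. k \<in> K \<Longrightarrow> f k \<in> N \<rightarrow>\<^sub>M P"
  shows "Measurable.pred N (\<lambda>x. \<forall>i\<in>I. \<exists>k\<in>K. le i (g x) (f k x))"
proof (intro pred_intros_finite assms(1,3))
  fix i k assume ik: "i \<in> I" "k \<in> K"
  show "Measurable.pred N (\<lambda>x. le i (g x) (f k x))"
    by (rule atomless_preorder.le_measurable'[OF assms(2)[OF ik(1)] assms(4) assms(5)[OF ik(2)]])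
qed

text \<open>
  Peel off the coordinate \<open>i\<close>: let \<open>x j\<close> be the maximal sample in it. Given \<open>x j\<close>, the other samples
  lie in the part of \<open>D\<close> below \<open>x j\<close>, and the induction hypothesis applies to this part with one
  coordinate and one sample less. As its probability is uniformly distributed on \<open>[0, prob D]\<close>,
  integration yields the recursion \<open>nn_integral_binomial_tail\<close>.
\<close>

lemma prob_box_le:
  fixes le :: "'i \<Rightarrow> 'b \<Rightarrow> 'b \<Rightarrow> bool" and J :: "'j set"
  assumes "prob_space P" and "finite I" and "\<And>i. i \<in> I \<Longrightarrow> atomless_preorder P (le i)"
    and "finite J" and "D \<in> sets P" and "0 \<le> p" "p \<le> measure P D"
  shows "emeasure (\<Pi>\<^sub>M j\<in>J. P) {x \<in> space (\<Pi>\<^sub>M j\<in>J. P). (\<forall>j\<in>J. x j \<in> D) \<and>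
      measure P {y \<in> space P. y \<in> D \<and> (\<forall>i\<in>I. \<exists>j\<in>J. le i y (x j))} < p}
    \<le> ennreal (binomial_tail (card I) (card J) (measure P D) p)"
  using assms(2-)
proof (induction I arbitrary: J D rule: finite_induct)
  case empty
  \<comment> \<open>With no coordinate the box is all of \<open>D\<close>, of probability at least
    \<open>p\<close>, so the event is empty.\<close>
  have "{y \<in> space P. y \<in> D} = D"
    using sets.sets_into_space[OF empty(3)] by auto
  then show ?case
    using empty by simp
next
  case (insert i I)
  interpret prob_space P by fact
  interpret atomless_preorder P "le i"
    using insert.prems(1) by simp
  interpret PJ: prob_space "\<Pi>\<^sub>M j\<in>J. P"
    by (intro prob_space_PiM) (rule \<open>prob_space P\<close>)
  interpret product_sigma_finite "\<lambda>_ :: 'j. P"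
    by standard
  note D [measurable] = \<open>D \<in> sets P\<close> and fin = \<open>finite J\<close> \<open>finite I\<close>
  have preorder: "atomless_preorder P (le i')" if "i' \<in> I" for i'
    using insert.prems(1) that by simp
  have I_preorder: "atomless_preorder P (le i')" if "i' \<in> insert i I" for i'
    using insert.prems(1) that by simp
  let ?c = "prob D" and ?M = "\<Pi>\<^sub>M j\<in>J. P"
  let ?E = "{x \<in> space ?M. (\<forall>j\<in>J. x j \<in> D) \<and>
    prob {y \<in> space P. y \<in> D \<and> (\<forall>i\<in>insert i I. \<exists>j\<in>J. le i y (x j))} < p}"
  show ?case
  proof (cases "J = {}")
    case True
    have "card (insert i I) = Suc (card I)"
      using insert by simp
    then show ?thesis
      using True PJ.emeasure_le_1 by (simp add: binomial_tail_Suc_0)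
  next
    case False
    then obtain m where m: "card J = Suc m"
      using fin by (metis card_0_eq not0_implies_Suc)
    \<comment> \<open>If even the sample maximal in coordinate \<open>i\<close> falls into
      \<open>B\<close>, all samples do; this accounts for the summand \<open>p ^ card J\<close> of
      the recursion.\<close>
    define B where "B = {z \<in> space P. z \<in> D \<and> cumul D z < p}"
    have B [measurable]: "B \<in> sets P"
      unfolding B_def by measurable
    have "prob B \<le> prob {z \<in> space P. z \<in> D \<and> cumul D z \<le> p}"
      unfolding B_def by (intro finite_measure_mono) auto
    also have "\<dots> \<le> p"
      using prob_cumul_le[OF D \<open>0 \<le> p\<close>] .
    finally have pB: "prob B \<le> p" .
    \<comment> \<open>Here \<open>x j\<close> is maximal in coordinate \<open>i\<close> and outside
      \<open>B\<close>. The coordinates in \<open>I\<close> are checked only against the remaining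
      samples, which shrinks the box and so enlarges the event. The bound \<open>i\<close> of the
      inner quantifier shadows the peeled coordinate.\<close>
    define F where "F j = {x \<in> space ?M. x j \<in> D \<and> p \<le> cumul D (x j) \<and>
      (\<forall>k\<in>J - {j}. x k \<in> D \<and> le i (x k) (x j)) \<and>
      prob {y \<in> space P. y \<in> D \<and> le i y (x j) \<and> (\<forall>i\<in>I. \<exists>k\<in>J - {j}. le i y (x k))} < p}" for j
    have F_sets [measurable]: "F j \<in> sets ?M" if [measurable]: "j \<in> J" for j
    proof -
      have [measurable]: "Measurable.pred (?M \<Otimes>\<^sub>M P) (\<lambda>z. \<forall>i\<in>I. \<exists>k\<in>J - {j}. le i (snd z) (fst z k))"
        using fin preorder by (intro pred_box) auto
      have [measurable]: "Measurable.pred ?M (\<lambda>x. \<forall>k\<in>J - {j}. x k \<in> D \<and> le i (x k) (x j))"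
        using fin by (intro pred_intros_finite) auto
      show ?thesis
        unfolding F_def by measurable
    qed
    have "?E \<subseteq> Pi\<^sub>E J (\<lambda>_. B) \<union> (\<Union>j\<in>J. F j)"
    proof
      fix x assume x: "x \<in> ?E"
      obtain j where j: "j \<in> J" "\<And>k. k \<in> J \<Longrightarrow> le i (x k) (x j)"
        using obtain_maximal fin(1) False by metis
      have x_space: "x k \<in> space P" if "k \<in> J" for k
        using x that by (auto simp: space_PiM)
      show "x \<in> Pi\<^sub>E J (\<lambda>_. B) \<union> (\<Union>j\<in>J. F j)"
      proof (cases "cumul D (x j) < p")
        case True
        have "cumul D (x k) < p" if "k \<in> J" for k
          using cumul_mono[OF D j(2)[OF that] x_space[OF j(1)]] True by simp
        then have "x \<in> Pi\<^sub>E J (\<lambda>_. B)"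
          using x x_space by (auto simp: B_def space_PiM PiE_def)
        then show ?thesis ..
      next
        case False
        have [measurable]: "Measurable.pred P (\<lambda>y. \<forall>i\<in>insert i I. \<exists>j\<in>J. le i y (x j))"
          using fin I_preorder x_space by (intro pred_box) auto
        have "{y \<in> space P. y \<in> D \<and> (\<forall>i\<in>insert i I. \<exists>j\<in>J. le i y (x j))} \<in> events"
          by measurable
        then have "prob {y \<in> space P. y \<in> D \<and> le i y (x j) \<and> (\<forall>i\<in>I. \<exists>k\<in>J - {j}. le i y (x k))} \<le>
            prob {y \<in> space P. y \<in> D \<and> (\<forall>i\<in>insert i I. \<exists>j\<in>J. le i y (x j))}"
          using j(1) by (intro finite_measure_mono) blast+
        then have "x \<in> F j"
          using x j False by (auto simp: F_def)
        then show ?thesis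
          using j(1) by blast
      qed
    qed
    then have "emeasure ?M ?E \<le> emeasure ?M (Pi\<^sub>E J (\<lambda>_. B) \<union> (\<Union>j\<in>J. F j))"
      using fin by (intro emeasure_mono) (auto intro!: sets.Un sets_PiM_I_finite sets.finite_UN)
    also have "\<dots> \<le> emeasure ?M (Pi\<^sub>E J (\<lambda>_. B)) + emeasure ?M (\<Union>j\<in>J. F j)"
      using fin by (intro emeasure_subadditive) (auto intro!: sets_PiM_I_finite sets.finite_UN)
    also have "emeasure ?M (\<Union>j\<in>J. F j) \<le> (\<Sum>j\<in>J. emeasure ?M (F j))"
      using fin by (intro emeasure_subadditive_finite) auto
    also have "emeasure ?M (Pi\<^sub>E J (\<lambda>_. B)) \<le> ennreal (p ^ Suc m)"
      using fin pB m
      by (simp add: emeasure_PiM emeasure_eq_measure ennreal_power power_mono ennreal_leI del: power_Suc)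
    also have "(\<Sum>j\<in>J. emeasure ?M (F j)) \<le>
        (\<Sum>j\<in>J. \<integral>\<^sup>+ u. ennreal (binomial_tail (card I) m u p) * indicator {p..?c} u \<partial>lborel)"
    proof (rule sum_mono)
      fix j assume j: "j \<in> J"
      define K where "K = J - {j}"
      have K: "J = insert j K" "j \<notin> K" "finite K" "card K = m"
        using j fin m by (auto simp: K_def)
      let ?f = "\<lambda>u. ennreal (binomial_tail (card I) m u p) * indicator {p..} u"
      have "emeasure ?M (F j) = (\<integral>\<^sup>+ x. indicator (F j) x \<partial>?M)"
        using j by simp
      \<comment> \<open>Fubini with \<open>x j = y\<close> in the outer integral, so that
        \<open>y\<close> is fixed while the induction hypothesis bounds the other samples.\<close>
      also have "\<dots> = (\<integral>\<^sup>+ y. (\<integral>\<^sup>+ x. indicator (F j) (x(j := y)) \<partial>(\<Pi>\<^sub>M k\<in>K. P)) \<partial>P)"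
        unfolding K(1) using F_sets[OF j] K by (intro product_nn_integral_insert_rev) auto
      also have "\<dots> \<le> (\<integral>\<^sup>+ y. ?f (cumul D y) * indicator D y \<partial>P)"
      proof (intro nn_integral_mono)
        fix y assume y [measurable]: "y \<in> space P"
        define D' where "D' = {x \<in> space P. x \<in> D \<and> le i x y}"
        have D' [measurable]: "D' \<in> sets P"
          unfolding D'_def by measurable
        have prob_D': "prob D' = cumul D y"
          unfolding D'_def cumul_def ..
        let ?G = "{x \<in> space (\<Pi>\<^sub>M k\<in>K. P). (\<forall>k\<in>K. x k \<in> D') \<and>
          prob {y \<in> space P. y \<in> D' \<and> (\<forall>i\<in>I. \<exists>k\<in>K. le i y (x k))} < p}"
        have [measurable]: "?G \<in> sets (\<Pi>\<^sub>M k\<in>K. P)"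
        proof -
          have [measurable]: "Measurable.pred ((\<Pi>\<^sub>M k\<in>K. P) \<Otimes>\<^sub>M P) (\<lambda>z. \<forall>i\<in>I. \<exists>k\<in>K. le i (snd z) (fst z k))"
            using fin K preorder by (intro pred_box) auto
          have [measurable]: "Measurable.pred (\<Pi>\<^sub>M k\<in>K. P) (\<lambda>x. \<forall>k\<in>K. x k \<in> D')"
            using K by (intro pred_intros_finite) auto
          show ?thesis
            by measurable
        qed
        have "indicator (F j) (x(j := y)) \<le>
            indicator ?G x * (indicator {p..} (cumul D y) * indicator D y :: ennreal)"
          if x: "x \<in> space (\<Pi>\<^sub>M k\<in>K. P)" for x
        proof (cases "x(j := y) \<in> F j")
          case True
          have upd: "(x(j := y)) k = x k" if "k \<in> K" for k
            using that K(2) by auto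
          have py: "p \<le> cumul D y" "y \<in> D" and K_le: "\<And>k. k \<in> K \<Longrightarrow> x k \<in> D \<and> le i (x k) y"
            using True upd unfolding F_def K_def[symmetric] by auto
          have "(\<exists>k\<in>K. le i' z ((x(j := y)) k)) \<longleftrightarrow> (\<exists>k\<in>K. le i' z (x k))" for i' z
            using upd by (intro bex_cong) simp_all
          then have "prob {z \<in> space P. z \<in> D \<and> le i z y \<and> (\<forall>i\<in>I. \<exists>k\<in>K. le i z (x k))} < p"
            using True unfolding F_def K_def[symmetric] by (simp only: mem_Collect_eq fun_upd_same)
          moreover have "{z \<in> space P. z \<in> D \<and> le i z y \<and> (\<forall>i\<in>I. \<exists>k\<in>K. le i z (x k))} =
              {z \<in> space P. z \<in> D' \<and> (\<forall>i\<in>I. \<exists>k\<in>K. le i z (x k))}"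
            unfolding D'_def by blast
          moreover have "x k \<in> D'" if "k \<in> K" for k
            using x that K_le by (auto simp: space_PiM D'_def)
          ultimately have "x \<in> ?G"
            using x by simp
          then show ?thesis
            using py by (simp add: indicator_def)
        qed simp
        then have "(\<integral>\<^sup>+ x. indicator (F j) (x(j := y)) \<partial>(\<Pi>\<^sub>M k\<in>K. P)) \<le>
            (\<integral>\<^sup>+ x. indicator ?G x * (indicator {p..} (cumul D y) * indicator D y) \<partial>(\<Pi>\<^sub>M k\<in>K. P))"
          by (intro nn_integral_mono)
        also have "\<dots> = emeasure (\<Pi>\<^sub>M k\<in>K. P) ?G * (indicator {p..} (cumul D y) * indicator D y)"
          by (simp add: nn_integral_multc)
        also have "\<dots> \<le> ?f (cumul D y) * indicator D y"
        proof (cases "p \<le> cumul D y")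
          case True
          then have "emeasure (\<Pi>\<^sub>M k\<in>K. P) ?G \<le> ennreal (binomial_tail (card I) m (cumul D y) p)"
            using insert.IH[of K D'] preorder K D' \<open>0 \<le> p\<close> unfolding prob_D' by simp
          then show ?thesis
            by (simp add: mult.assoc mult_right_mono)
        qed simp
        finally show "(\<integral>\<^sup>+ x. indicator (F j) (x(j := y)) \<partial>(\<Pi>\<^sub>M k\<in>K. P)) \<le> ?f (cumul D y) * indicator D y" .
      qed
      also have "\<dots> = (\<integral>\<^sup>+ u. ?f u * indicator {0..?c} u \<partial>lborel)"
        by (rule nn_integral_cumul[OF D]) simp
      also have "\<dots> = (\<integral>\<^sup>+ u. ennreal (binomial_tail (card I) m u p) * indicator {p..?c} u \<partial>lborel)"
        using \<open>0 \<le> p\<close> by (intro nn_integral_cong) (auto split: split_indicator)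
      finally show "emeasure ?M (F j) \<le>
        (\<integral>\<^sup>+ u. ennreal (binomial_tail (card I) m u p) * indicator {p..?c} u \<partial>lborel)" .
    qed
    also have "(\<Sum>j\<in>J. \<integral>\<^sup>+ u. ennreal (binomial_tail (card I) m u p) * indicator {p..?c} u \<partial>lborel) =
        (\<integral>\<^sup>+ u. ennreal (real (Suc m) * binomial_tail (card I) m u p) * indicator {p..?c} u \<partial>lborel)"
      using \<open>0 \<le> p\<close>
      by (simp add: m nn_integral_cmult[symmetric] ennreal_mult' ennreal_of_nat_eq_real_of_nat mult.assoc
          del: of_nat_Suc)
    also have "\<dots> = ennreal (binomial_tail (Suc (card I)) (Suc m) ?c p - p ^ Suc m)"
      using \<open>0 \<le> p\<close> \<open>p \<le> ?c\<close> by (rule nn_integral_binomial_tail)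
    also have "ennreal (p ^ Suc m) + \<dots> = ennreal (binomial_tail (card (insert i I)) (card J) ?c p)"
    proof -
      \<comment> \<open>The subtracted power is the term \<open>s = 0\<close> of the tail, so
        \<open>ennreal\<close> does not truncate the difference.\<close>
      have "p ^ Suc m \<le> binomial_tail (Suc (card I)) (Suc m) ?c p"
        unfolding binomial_tail_def sum.lessThan_Suc_shift
        using \<open>0 \<le> p\<close> \<open>p \<le> ?c\<close> by (auto intro!: sum_nonneg simp del: binomial_Suc_Suc)
      then show ?thesis
        using \<open>0 \<le> p\<close> m insert.hyps by (simp flip: ennreal_plus del: power_Suc)
    qed
    finally show ?thesis
      by (simp add: add_mono)
  qed
qed

subsection \<open>Exceedance probabilities\<close>

lemma prob_space_unit_interval: "prob_space (uniform_measure lborel {0..1 :: real})"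
  by (rule prob_space_uniform_measure) auto

text \<open>
  An independent uniform variable breaks the ties between equal values of \<open>X\<close>, so that no
  assumption on the distribution of \<open>X\<close> is needed.
\<close>

lemma atomless_preorder_lex:
  fixes X :: "'a \<Rightarrow> real"
  assumes "prob_space M" and [measurable]: "X \<in> borel_measurable M"
  shows "atomless_preorder (M \<Otimes>\<^sub>M uniform_measure lborel {0..1 :: real})
    (\<lambda>y z. X (fst y) < X (fst z) \<or> X (fst y) = X (fst z) \<and> snd y \<le> snd z)"
    (is "atomless_preorder ?Q ?le")
proof -
  interpret M: prob_space M by fact
  interpret U: prob_space "uniform_measure lborel {0..1 :: real}"
    by (rule prob_space_unit_interval)
  interpret Q: pair_prob_space M "uniform_measure lborel {0..1 :: real}" ..
  show ?thesis
  proof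
    show "Measurable.pred (?Q \<Otimes>\<^sub>M ?Q) (\<lambda>(y, z). ?le y z)"
      by measurable
    show "measure ?Q {y \<in> space ?Q. ?le y z \<and> ?le z y} = 0" if "z \<in> space ?Q" for z
    proof -
      \<comment> \<open>Mutual comparison forces equal tie-breakers, and a single value of the
        uniform variable is null.\<close>
      have "measure ?Q {y \<in> space ?Q. ?le y z \<and> ?le z y} \<le> measure ?Q (space M \<times> {snd z})"
        by (intro Q.finite_measure_mono) (auto simp: space_pair_measure)
      also have "measure ?Q (space M \<times> {snd z}) = 0"
      proof -
        have "emeasure lborel ({0..1} \<inter> {snd z}) \<le> emeasure lborel {snd z}"
          by (intro emeasure_mono) auto
        then show ?thesis
          unfolding measure_def by (subst U.emeasure_pair_measure_Times) auto
      qed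
      finally show ?thesis
        using measure_nonneg[of ?Q] by (intro order_antisym) simp_all
    qed
  qed auto
qed

lemma prob_exceedance_gt_sets:
  fixes X :: "'i \<Rightarrow> 'a \<Rightarrow> real"
  assumes "prob_space M" and [measurable]: "\<And>i. i \<in> I \<Longrightarrow> X i \<in> borel_measurable M"
    and fin: "finite I" "finite J"
  shows "{x \<in> space (\<Pi>\<^sub>M j\<in>J. M). \<nu> < measure M {y \<in> space M. \<exists>i\<in>I. \<forall>j\<in>J. X i (x j) < X i y}}
    \<in> sets (\<Pi>\<^sub>M j\<in>J. M)"
proof -
  interpret M: prob_space M by fact
  have [measurable]: "Measurable.pred ((\<Pi>\<^sub>M j\<in>J. M) \<Otimes>\<^sub>M M) (\<lambda>z. \<exists>i\<in>I. \<forall>j\<in>J. X i (fst z j) < X i (snd z))"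
  proof (intro pred_intros_finite fin)
    fix i j assume [measurable]: "i \<in> I" "j \<in> J"
    show "Measurable.pred ((\<Pi>\<^sub>M j\<in>J. M) \<Otimes>\<^sub>M M) (\<lambda>z. X i (fst z j) < X i (snd z))"
      by measurable
  qed
  show ?thesis
    by measurable
qed

text \<open>Each outcome is extended by one uniform variable serving all coordinates;
  \<open>fst\<close> maps extended samples back to the original ones. Exceedance above
  \<open>\<nu>\<close> leaves less than \<open>1 - \<nu>\<close> for the box, so
  \<open>prob_box_le\<close> applies with the whole space as \<open>D\<close>.\<close>

lemma prob_exceedance_gt_le:
  fixes X :: "'i \<Rightarrow> 'a \<Rightarrow> real"
  assumes "prob_space M" and [measurable]: "\<And>i. i \<in> I \<Longrightarrow> X i \<in> borel_measurable M"
    and fin: "finite I" "finite J" and \<nu>: "0 \<le> \<nu>" "\<nu> \<le> 1"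
  shows "measure (\<Pi>\<^sub>M j\<in>J. M)
      {x \<in> space (\<Pi>\<^sub>M j\<in>J. M). \<nu> < measure M {y \<in> space M. \<exists>i\<in>I. \<forall>j\<in>J. X i (x j) < X i y}}
    \<le> binomial_tail (card I) (card J) 1 (1 - \<nu>)"
proof -
  let ?U = "uniform_measure lborel {0..1 :: real}"
  define Q where "Q = M \<Otimes>\<^sub>M ?U"
  define le where "le i y z \<longleftrightarrow> X i (fst y) < X i (fst z) \<or> X i (fst y) = X i (fst z) \<and> snd y \<le> snd z"
    for i and y z :: "'a \<times> real"
  interpret M: prob_space M by fact
  interpret U: prob_space ?U
    by (rule prob_space_unit_interval)
  interpret MU: pair_prob_space M ?U ..
  interpret Q: prob_space Q
    unfolding Q_def by (rule MU.prob_space_axioms)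
  interpret MJ: prob_space "\<Pi>\<^sub>M j\<in>J. M"
    by (intro prob_space_PiM) (rule \<open>prob_space M\<close>)
  have fst_Q [measurable]: "fst \<in> Q \<rightarrow>\<^sub>M M"
    unfolding Q_def by measurable
  have le: "atomless_preorder Q (le i)" if "i \<in> I" for i
    using atomless_preorder_lex[OF \<open>prob_space M\<close> assms(2)[OF that]]
    unfolding Q_def le_def[abs_def] .
  have distr_Q: "distr Q M fst = M"
    unfolding Q_def by (rule U.distr_pair_fst)
  have "distr (\<Pi>\<^sub>M j\<in>J. Q) (\<Pi>\<^sub>M j\<in>J. M) (compose J fst) = (\<Pi>\<^sub>M j\<in>J. distr Q M fst)"
    by (rule distr_PiM_finite_prob_space') (auto intro: fin \<open>prob_space M\<close> Q.prob_space_axioms)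
  then have distr: "distr (\<Pi>\<^sub>M j\<in>J. Q) (\<Pi>\<^sub>M j\<in>J. M) (compose J fst) = (\<Pi>\<^sub>M j\<in>J. M)"
    unfolding distr_Q .
  have comp [measurable]: "compose J fst \<in> (\<Pi>\<^sub>M j\<in>J. Q) \<rightarrow>\<^sub>M (\<Pi>\<^sub>M j\<in>J. M)"
    unfolding compose_def by measurable
  let ?V = "\<lambda>x. measure M {y \<in> space M. \<exists>i\<in>I. \<forall>j\<in>J. X i (x j) < X i y}"
  let ?E = "{x \<in> space (\<Pi>\<^sub>M j\<in>J. M). \<nu> < ?V x}"
  let ?F = "{x \<in> space (\<Pi>\<^sub>M j\<in>J. Q). (\<forall>j\<in>J. x j \<in> space Q) \<and>
    measure Q {y \<in> space Q. y \<in> space Q \<and> (\<forall>i\<in>I. \<exists>j\<in>J. le i y (x j))} < 1 - \<nu>}"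
  have E: "?E \<in> sets (\<Pi>\<^sub>M j\<in>J. M)"
    using assms by (intro prob_exceedance_gt_sets) auto
  have F: "?F \<in> sets (\<Pi>\<^sub>M j\<in>J. Q)"
  proof -
    have [measurable]: "Measurable.pred ((\<Pi>\<^sub>M j\<in>J. Q) \<Otimes>\<^sub>M Q) (\<lambda>z. \<forall>i\<in>I. \<exists>j\<in>J. le i (snd z) (fst z j))"
      using fin le by (intro pred_box) auto
    have [measurable]: "Measurable.pred (\<Pi>\<^sub>M j\<in>J. Q) (\<lambda>x. \<forall>j\<in>J. x j \<in> space Q)"
      using fin by (intro pred_intros_finite) auto
    show ?thesis
      by measurable
  qed
  have "emeasure (\<Pi>\<^sub>M j\<in>J. M) ?E =
      emeasure (\<Pi>\<^sub>M j\<in>J. Q) (compose J fst -` ?E \<inter> space (\<Pi>\<^sub>M j\<in>J. Q))"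
    using E by (subst distr[symmetric]) (simp add: emeasure_distr)
  also have "\<dots> \<le> emeasure (\<Pi>\<^sub>M j\<in>J. Q) ?F"
  proof (intro emeasure_mono F subsetI)
    fix x assume x: "x \<in> compose J fst -` ?E \<inter> space (\<Pi>\<^sub>M j\<in>J. Q)"
    let ?A = "{y \<in> space M. \<exists>i\<in>I. \<forall>j\<in>J. X i (fst (x j)) < X i y}"
    have x_space: "x j \<in> space Q" if "j \<in> J" for j
      using x that by (auto simp: space_PiM)
    then have fst_space [measurable]: "fst (x j) \<in> space M" if "j \<in> J" for j
      using measurable_space[OF fst_Q] that by blast
    have [measurable]: "Measurable.pred M (\<lambda>y. \<exists>i\<in>I. \<forall>j\<in>J. X i (fst (x j)) < X i y)"
    proof (intro pred_intros_finite fin)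
      fix i j assume [measurable]: "i \<in> I" "j \<in> J"
      show "Measurable.pred M (\<lambda>y. X i (fst (x j)) < X i y)"
        by measurable
    qed
    have A: "?A \<in> sets M"
      by measurable
    have A': "fst -` ?A \<inter> space Q \<in> sets Q"
      using fst_Q A by (rule measurable_sets)
    have "?V (compose J fst x) = measure M ?A"
      by (simp add: compose_def cong: ball_cong)
    then have "\<nu> < measure M ?A"
      using x by simp
    also have "measure M ?A = measure Q (fst -` ?A \<inter> space Q)"
      using A by (subst distr_Q[symmetric]) (rule measure_distr, auto)
    finally have "\<nu> < measure Q (fst -` ?A \<inter> space Q)" .
    \<comment> \<open>\<open>le i\<close> implies the weak inequality between the values of
      \<open>X i\<close>, so no point of the box exceeds all samples in a coordinate.\<close>
    moreover have "{y \<in> space Q. y \<in> space Q \<and> (\<forall>i\<in>I. \<exists>j\<in>J. le i y (x j))} \<subseteq> space Q - (fst -` ?A \<inter> space Q)"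
      unfolding le_def by fastforce
    then have "measure Q {y \<in> space Q. y \<in> space Q \<and> (\<forall>i\<in>I. \<exists>j\<in>J. le i y (x j))} \<le>
        measure Q (space Q - (fst -` ?A \<inter> space Q))"
      using A' by (intro Q.finite_measure_mono) auto
    ultimately have "measure Q {y \<in> space Q. y \<in> space Q \<and> (\<forall>i\<in>I. \<exists>j\<in>J. le i y (x j))} < 1 - \<nu>"
      using Q.prob_compl[OF A'] by linarith
    then show "x \<in> ?F"
      using x x_space by blast
  qed
  also have "\<dots> \<le> ennreal (binomial_tail (card I) (card J) (measure Q (space Q)) (1 - \<nu>))"
    using \<nu> by (intro prob_box_le Q.prob_space_axioms fin le) (auto simp: Q.prob_space)
  finally show ?thesis
    using \<nu> by (simp add: Q.prob_space MJ.emeasure_eq_measure binomial_tail_nonneg)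
qed

text \<open>
  Each term of the tail with \<open>u = 1\<close> is compared with the corresponding binomial probability, at most \<open>1\<close>,
  for a success rate \<open>1 - q\<close> with \<open>p < q < 1\<close>.
\<close>

lemma binomial_tail_tendsto_0:
  assumes "0 \<le> p" "p < 1"
  shows "(\<lambda>m. binomial_tail d m 1 p) \<longlonglongrightarrow> 0"
proof -
  define q where "q = (p + 1) / 2"
  have q: "p < q" "q < 1" "0 < q"
    using assms by (auto simp: q_def)
  have le_1: "real (m choose s) * (1 - q) ^ s * q ^ (m - s) \<le> 1" for m s
  proof (cases "s \<le> m")
    case True
    have "real (m choose s) * (1 - q) ^ s * q ^ (m - s) \<le>
        (\<Sum>s\<le>m. real (m choose s) * (1 - q) ^ s * q ^ (m - s))"
      using True q by (intro member_le_sum) auto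
    also have "\<dots> = (1 - q + q) ^ m"
      by (rule binomial_ring[symmetric])
    finally show ?thesis
      by simp
  qed (simp add: binomial_eq_0)
  have "(\<lambda>m. real (m choose s) * (1 - p) ^ s * p ^ (m - s)) \<longlonglongrightarrow> 0" for s
  \<comment> \<open>Shifting the index by \<open>s\<close> turns the exponent \<open>m - s\<close>
    into \<open>m\<close>; comparison with \<open>q\<close> leaves the geometric factor
    \<open>(p / q) ^ m\<close>.\<close>
  proof (rule LIMSEQ_offset[where k = s], rule tendsto_sandwich)
    let ?r = "(1 - p) / (1 - q)"
    show "\<forall>\<^sub>F m in sequentially. 0 \<le> real (m + s choose s) * (1 - p) ^ s * p ^ (m + s - s)"
      using assms by simp
    have "real (m + s choose s) * (1 - p) ^ s * p ^ (m + s - s) \<le> ?r ^ s * (p / q) ^ m" for m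
    proof -
      have "real (m + s choose s) * (1 - p) ^ s * p ^ m =
          (real (m + s choose s) * (1 - q) ^ s * q ^ (m + s - s)) * (?r ^ s * (p / q) ^ m)"
        using q by (simp add: power_divide)
      also have "\<dots> \<le> 1 * (?r ^ s * (p / q) ^ m)"
        using q assms by (intro mult_right_mono le_1) auto
      finally show ?thesis
        by simp
    qed
    then show "\<forall>\<^sub>F m in sequentially.
        real (m + s choose s) * (1 - p) ^ s * p ^ (m + s - s) \<le> ?r ^ s * (p / q) ^ m"
      by simp
    show "(\<lambda>m. ?r ^ s * (p / q) ^ m) \<longlonglongrightarrow> 0"
      using q assms by (intro tendsto_mult_right_zero LIMSEQ_power_zero) auto
  qed simp
  then have "(\<lambda>m. \<Sum>s<d. real (m choose s) * (1 - p) ^ s * p ^ (m - s)) \<longlonglongrightarrow> (\<Sum>s<d. 0)"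
    by (intro tendsto_sum)
  then show ?thesis
    unfolding binomial_tail_def by simp
qed

subsection \<open>Scenario numbers and confidence levels\<close>

lemma index_set_simps [simp]: "finite (index_set n)" "card (index_set n) = Suc n"
proof -
  have "index_set n = {0..n}"
    by (auto simp: index_set_def)
  then show "finite (index_set n)" "card (index_set n) = Suc n"
    by simp_all
qed

lemma conf_level_pos: "0 < \<kappa> \<Longrightarrow> 1 \<le> t \<Longrightarrow> 0 < conf_level \<kappa> t"
  by (simp add: conf_level_def)

text \<open>Basel series: the inverse squares sum to \<open>pi ^ 2 / 6\<close>. The shift by
  \<open>Suc\<close> reflects that \<open>t\<close> starts at \<open>1\<close>.\<close>

lemma conf_level_sums: "(\<lambda>t. conf_level \<kappa> (Suc t)) sums \<kappa>"
  using sums_mult[OF inverse_squares_sums, of "6 * \<kappa> / pi\<^sup>2"]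
  by (simp add: conf_level_def add.commute)

text \<open>Holds because \<open>6 < 9 < pi ^ 2\<close>.\<close>

lemma conf_level_less_1:
  assumes "0 < \<kappa>" "\<kappa> < 1" "1 \<le> t"
  shows "conf_level \<kappa> t < 1"
proof -
  have "3 ^ 2 < pi ^ 2"
    using pi_gt3 by (intro power_strict_mono) auto
  moreover have "1 \<le> real t ^ 2"
    using \<open>1 \<le> t\<close> by simp
  ultimately have "6 * \<kappa> < pi ^ 2 * real t ^ 2"
    using assms mult_mono[of "3 ^ 2" "pi ^ 2" 1 "real t ^ 2"] by simp
  then show ?thesis
    using assms by (simp add: conf_level_def)
qed

lemma num_scenarios_Least:
  "num_scenarios n \<nu> \<kappa> t = (LEAST m. binomial_tail (Suc n) m 1 (1 - \<nu>) \<le> conf_level \<kappa> t)"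
  unfolding num_scenarios_def binomial_tail_def
  by (simp add: atLeast0AtMost flip: lessThan_Suc_atMost)

text \<open>The tail tends to \<open>0\<close> and the level is positive, so some number qualifies
  and \<open>LEAST\<close> is attained.\<close>

lemma binomial_tail_num_scenarios:
  assumes "0 < \<nu>" "\<nu> < 1" "0 < \<kappa>" "1 \<le> t"
  shows "binomial_tail (Suc n) (num_scenarios n \<nu> \<kappa> t) 1 (1 - \<nu>) \<le> conf_level \<kappa> t"
proof -
  have "\<forall>\<^sub>F m in sequentially. binomial_tail (Suc n) m 1 (1 - \<nu>) < conf_level \<kappa> t"
    using assms by (intro order_tendstoD[OF binomial_tail_tendsto_0] conf_level_pos) auto
  then obtain m where "binomial_tail (Suc n) m 1 (1 - \<nu>) < conf_level \<kappa> t"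
    using eventually_happens'[OF sequentially_bot] by blast
  then have "binomial_tail (Suc n) m 1 (1 - \<nu>) \<le> conf_level \<kappa> t"
    by simp
  then show ?thesis
    unfolding num_scenarios_Least by (rule LeastI)
qed

text \<open>Without scenarios the tail is \<open>1\<close>, above every level. Positivity makes the
  set under \<open>Max\<close> in \<open>noise_bound\<close> nonempty.\<close>

lemma num_scenarios_pos:
  assumes "0 < \<nu>" "\<nu> < 1" "0 < \<kappa>" "\<kappa> < 1" "1 \<le> t"
  shows "0 < num_scenarios n \<nu> \<kappa> t"
proof (rule ccontr)
  assume "\<not> 0 < num_scenarios n \<nu> \<kappa> t"
  then have "1 \<le> conf_level \<kappa> t"
    using binomial_tail_num_scenarios[of \<nu> \<kappa> t n] assms by (simp add: binomial_tail_Suc_0)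
  then show False
    using conf_level_less_1[of \<kappa> t] assms by simp
qed

text \<open>Turns the violation into an exceedance probability: a maximum is below a value iff all
  members are.\<close>

lemma violation_noise_bound:
  assumes "0 < m t"
  shows "violation M n \<epsilon> t (noise_bound \<epsilon> m \<omega> t) =
    measure M {y \<in> space M. \<exists>i\<in>index_set n. \<forall>j\<in>{1..m t}. \<bar>\<epsilon> t (\<omega> t j) i\<bar> < \<bar>\<epsilon> t y i\<bar>}"
proof -
  have "noise_bound \<epsilon> m \<omega> t i < a \<longleftrightarrow> (\<forall>j\<in>{1..m t}. \<bar>\<epsilon> t (\<omega> t j) i\<bar> < a)" for i a
    using assms unfolding noise_bound_def scenario_def by (subst Max_less_iff) auto
  then show ?thesis
    unfolding violation_def by simp
qed

section \<open>Union bound over all iterations\<close>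

theorem theorem1:
  fixes M :: "'a measure" and n :: nat
    and \<epsilon> :: "nat \<Rightarrow> 'a \<Rightarrow> nat \<Rightarrow> real"
    and \<nu> \<kappa> :: real
  defines "m \<equiv> num_scenarios n \<nu> \<kappa>"
  defines "N \<equiv> master_space M m"
  assumes "prob_space M"
    and "\<And>t. t \<ge> 1 \<Longrightarrow> \<epsilon> t \<in> M \<rightarrow>\<^sub>M (\<Pi>\<^sub>M i\<in>index_set n. borel)"
    and "0 < \<nu>" "\<nu> < 1" "0 < \<kappa>" "\<kappa> < 1"
  shows "(\<Union>t\<in>{1..}. {\<omega> \<in> space N. violation M n \<epsilon> t (noise_bound \<epsilon> m \<omega> t) > \<nu>}) \<in> sets N
      \<and> measure N {\<omega> \<in> space N. \<forall>t\<ge>1. violation M n \<epsilon> t (noise_bound \<epsilon> m \<omega> t) \<le> \<nu>} \<ge> 1 - \<kappa>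
      \<and> measure N (\<Union>t\<in>{1..}. {\<omega> \<in> space N. violation M n \<epsilon> t (noise_bound \<epsilon> m \<omega> t) > \<nu>}) \<le> \<kappa>"
proof -
  interpret M: prob_space M by fact
  let ?S = "\<lambda>t. \<Pi>\<^sub>M j\<in>{1..m t}. M"
  have prob_S: "prob_space (?S t)" for t
    by (intro prob_space_PiM) (rule \<open>prob_space M\<close>)
  interpret N: prob_space N
    unfolding N_def master_space_def by (intro prob_space_PiM prob_S)
  let ?B = "\<lambda>t. {\<omega> \<in> space N. violation M n \<epsilon> t (noise_bound \<epsilon> m \<omega> t) > \<nu>}"
  define E where "E t = {x \<in> space (?S t). \<nu> <
    measure M {y \<in> space M. \<exists>i\<in>index_set n. \<forall>j\<in>{1..m t}. \<bar>\<epsilon> t (x j) i\<bar> < \<bar>\<epsilon> t y i\<bar>}}" for t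
  have B: "?B t \<in> sets N \<and> measure N (?B t) \<le> conf_level \<kappa> t" if t: "1 \<le> t" for t
  proof -
    have \<epsilon> [measurable]: "(\<lambda>y. \<bar>\<epsilon> t y i\<bar>) \<in> borel_measurable M" if "i \<in> index_set n" for i
      using measurable_compose[OF assms(4)[OF t] measurable_component_singleton[OF that]]
      by (rule borel_measurable_abs)
    have E_sets: "E t \<in> sets (?S t)"
      unfolding E_def by (intro prob_exceedance_gt_sets \<open>prob_space M\<close> \<epsilon>) auto
    have comp: "(\<lambda>\<omega>. \<omega> t) \<in> N \<rightarrow>\<^sub>M ?S t"
      unfolding N_def master_space_def using t by (intro measurable_component_singleton) auto
    have "0 < m t"
      unfolding m_def using assms t by (intro num_scenarios_pos) auto
    \<comment> \<open>The event constrains only the component \<open>t\<close> of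
      \<open>\<omega>\<close>, whose marginal under \<open>N\<close> is \<open>?S t\<close>, so the
      bound for a single iteration applies.\<close>
    then have B_eq: "?B t = (\<lambda>\<omega>. \<omega> t) -` E t \<inter> space N"
      using measurable_space[OF comp] by (auto simp: E_def violation_noise_bound)
    have "distr N (?S t) (\<lambda>\<omega>. \<omega> t) = ?S t"
      unfolding N_def master_space_def using t by (intro distr_PiM_component prob_S) auto
    then have "measure N (?B t) = measure (?S t) (E t)"
      unfolding B_eq using measure_distr[OF comp E_sets] by simp
    also have "\<dots> \<le> binomial_tail (card (index_set n)) (card {1..m t}) 1 (1 - \<nu>)"
      unfolding E_def using assms
      by (intro prob_exceedance_gt_le \<open>prob_space M\<close> \<epsilon>) auto
    also have "\<dots> \<le> conf_level \<kappa> t"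
      using binomial_tail_num_scenarios[of \<nu> \<kappa> t n] assms t by (simp add: m_def)
    finally show ?thesis
      using measurable_sets[OF comp E_sets] B_eq by simp
  qed
  let ?U = "\<Union>t\<in>{1..}. ?B t"
  have U_eq: "?U = (\<Union>t. ?B (Suc t))"
    by (auto simp: Suc_le_eq gr0_conv_Suc)
  have U_sets: "?U \<in> sets N"
    using B by (intro sets.countable_UN'') auto
  have summable: "summable (\<lambda>t. measure N (?B (Suc t)))"
    using B by (intro summable_comparison_test'[OF sums_summable[OF conf_level_sums]]) auto
  have "measure N ?U \<le> (\<Sum>t. measure N (?B (Suc t)))"
    unfolding U_eq using B summable by (intro N.finite_measure_subadditive_countably) auto
  also have "\<dots> \<le> (\<Sum>t. conf_level \<kappa> (Suc t))"
    using B by (intro suminf_le summable sums_summable[OF conf_level_sums]) auto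
  also have "\<dots> = \<kappa>"
    by (rule sums_unique[OF conf_level_sums, symmetric])
  finally have U_le: "measure N ?U \<le> \<kappa>" .
  have "{\<omega> \<in> space N. \<forall>t\<ge>1. violation M n \<epsilon> t (noise_bound \<epsilon> m \<omega> t) \<le> \<nu>} = space N - ?U"
    by (auto simp: not_less)
  then show ?thesis
    using U_sets U_le N.prob_compl[OF U_sets] by simp
qed

end
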